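(* Let $n,m$ be positive integers. Write $n=am+b$ with integers $a>0$ and $0<b<m$, and set $d=a+b$ and $k=\lfloor n/d\rfloor$. Let $\Delta$ be the regular configuration in $\mathrm{CONF}(a,b)$, with a fixed reading as in the context. Then for every integer $q$ with $1\le q\le k-1$, the cycles $C_{0,\Delta}$ and $C_{q(m-1),\Delta}$ have no common vertex.
   Context: $\mathrm{Shift}(n,m)$ is the directed graph with vertex set $\mathbb{Z}_n$ and arcs $i\to i+1$ and $i\to i+m$ (mod $n$). $\mathrm{CONF}(a,b)$ is the set of necklaces (circular arrangements up to rotation) of $a$ red and $b$ black beads. For a necklace with black beads $B_0,\dots,B_{b-1}$ in cyclic order, its characteristic sequence $\{x_0,\dots,x_{b-1}\}$ lists the number $x_i$ of red beads between $B_i$ and $B_{i+1}$. The necklace is regular if $\frac{a}{b}k'-1<x_i+\dots+x_{i+k'-1}<\frac{a}{b}k'+1$ for all $0\le i\le b-1$ and $1\le k'\le 1+\lfloor b/2\rfloor$ (indices mod $b$). There is a unique regular configuration in $\mathrm{CONF}(a,b)$. Fix a reading of $\Delta$: the beads $\beta_0,\dots,\beta_{d-1}$ in cyclic order from some starting bead. Set $l_p=m$ if $\beta_p$ is red and $l_p=1$ if black, so that $\sum_p l_p=n$. For $v\in\mathbb{Z}_n$, $C_{v,\Delta}$ is the cycle with vertex sequence $v,\ v+l_0,\ v+l_0+l_1,\ \dots,\ v+l_0+\dots+l_{d-2}$ (mod $n$), using the same reading for all $v$. *)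

theory Defs
  imports Complex_Main
begin

datatype bead = Red | Black

text \<open>
  A bead word is a reading of a circular arrangement: the beads in cyclic order from some
  starting bead. A necklace is represented by the set of all its readings.
\<close>

definition necklace :: "bead list \<Rightarrow> bead list set" where
  "necklace w = range (\<lambda>i. rotate i w)"

definition CONF :: "nat \<Rightarrow> nat \<Rightarrow> bead list set set" where
  "CONF a b = necklace ` {w. count_list w Red = a \<and> count_list w Black = b}"

definition black_positions :: "bead list \<Rightarrow> nat list" where
  "black_positions w = filter (\<lambda>p. w ! p = Black) [0..<length w]"

text \<open>
  For a black bead at position \<open>p\<close>, the list \<open>tl (rotate p w)\<close> consists of all the other beads
  in the cyclic order in which they follow it; its maximal red prefix is the block of red beads up
  to the next black bead (which is the same bead again if there is only one).
\<close>

definition char_seq :: "bead list \<Rightarrow> nat list" where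
  "char_seq w =
     map (\<lambda>p. length (takeWhile (\<lambda>c. c = Red) (tl (rotate p w)))) (black_positions w)"

definition regular_word :: "bead list \<Rightarrow> bool" where
  "regular_word w \<longleftrightarrow>
     (let a = count_list w Red; b = count_list w Black; x = char_seq w in
      \<forall>i<b. \<forall>k'\<in>{1..1 + b div 2}.
        real a / real b * real k' - 1 < real (\<Sum>j<k'. x ! ((i + j) mod b)) \<and>
        real (\<Sum>j<k'. x ! ((i + j) mod b)) < real a / real b * real k' + 1)"

text \<open>
  Regularity does not depend on the reading, see \<open>regular_necklace_iff\<close> below.
\<close>

definition regular :: "bead list set \<Rightarrow> bool" where
  "regular \<Delta> \<longleftrightarrow> (\<forall>w\<in>\<Delta>. regular_word w)"

text \<open>The residues modulo \<open>n\<close> are represented by \<open>{0..<n}\<close>.\<close>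

definition shift_arcs :: "nat \<Rightarrow> nat \<Rightarrow> (nat \<times> nat) set" where
  "shift_arcs n m = {(i, (i + 1) mod n) | i. i < n} \<union> {(i, (i + m) mod n) | i. i < n}"

fun bead_step :: "nat \<Rightarrow> bead \<Rightarrow> nat" where
  "bead_step m Red = m"
| "bead_step m Black = 1"

definition cycle_verts :: "nat \<Rightarrow> nat \<Rightarrow> bead list \<Rightarrow> nat \<Rightarrow> nat list" where
  "cycle_verts n m w v = map (\<lambda>j. (v + (\<Sum>p<j. bead_step m (w ! p))) mod n) [0..<length w]"

lemma sum_bead_step:
  "(\<Sum>p<length w. bead_step m (w ! p)) = count_list w Red * m + count_list w Black"
proof (induction w)
  case (Cons c w)
  then show ?case
    by (cases c) (simp_all add: sum.lessThan_Suc_shift del: sum.lessThan_Suc)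
qed simp

lemma cycle_verts_shift_arcs:
  assumes "n = count_list w Red * m + count_list w Black" "0 < n" "j < length w"
  shows "(cycle_verts n m w v ! j, cycle_verts n m w v ! (Suc j mod length w)) \<in> shift_arcs n m"
proof -
  let ?S = "\<lambda>j. (\<Sum>p<j. bead_step m (w ! p))"
  have nxt: "cycle_verts n m w v ! (Suc j mod length w) = (v + ?S (Suc j)) mod n"
  proof (cases "Suc j = length w")
    case True
    have "?S (Suc j) = n" unfolding True using assms(1) by (simp only: sum_bead_step)
    moreover have "w \<noteq> []" using assms(3) by auto
    ultimately show ?thesis using True by (simp add: cycle_verts_def del: sum.lessThan_Suc)
  next
    case False
    then show ?thesis using assms(3) by (simp add: cycle_verts_def)
  qed
  have cur: "cycle_verts n m w v ! j = (v + ?S j) mod n"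
    using assms(3) by (simp add: cycle_verts_def)
  have "(v + ?S (Suc j)) mod n = ((v + ?S j) mod n + bead_step m (w ! j)) mod n"
    by (simp add: add.assoc mod_add_left_eq)
  moreover have "bead_step m (w ! j) = 1 \<or> bead_step m (w ! j) = m"
    by (cases "w ! j") auto
  moreover have "(v + ?S j) mod n < n" using assms(2) by simp
  ultimately show ?thesis unfolding cur nxt shift_arcs_def by fastforce
qed

lemma distinct_cycle_verts:
  assumes "n = count_list w Red * m + count_list w Black" "0 < m"
  shows "distinct (cycle_verts n m w v)"
proof -
  let ?S = "\<lambda>j. (\<Sum>p<j. bead_step m (w ! p))"
  have step: "0 < bead_step m c" for c using assms(2) by (cases c) auto
  have mono: "?S i < ?S j" if "i < j" for i j
    using that by (induction j) (auto simp: less_Suc_eq intro: trans_less_add1 step)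
  have tot: "?S (length w) = n" using assms(1) by (simp only: sum_bead_step)
  have ne: "(v + ?S i) mod n \<noteq> (v + ?S j) mod n" if "i < j" "j < length w" for i j
  proof
    assume "(v + ?S i) mod n = (v + ?S j) mod n"
    then have "n dvd (v + ?S j) - (v + ?S i)"
      using mono[OF that(1)] by (metis mod_eq_dvd_iff_nat add_left_mono less_imp_le)
    then have "n dvd ?S j - ?S i" by simp
    moreover have "0 < ?S j - ?S i" using mono[OF that(1)] by simp
    moreover have "?S j - ?S i < n" using mono[OF that(2)] tot by simp
    ultimately show False by (simp add: nat_dvd_not_less)
  qed
  show ?thesis
    unfolding cycle_verts_def distinct_map
    by (auto intro!: inj_onI) (metis ne linorder_neqE_nat)
qed

lemma count_list_rotate1: "count_list (rotate1 w) c = count_list w c"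
  by (cases w) auto

lemma length_black_positions: "length (black_positions w) = count_list w Black"
  unfolding black_positions_def count_list_eq_length_filter length_filter_conv_card
  by (subst distinct_card[symmetric]) (auto intro!: arg_cong[where f = card])

lemma black_positions_Cons:
  "black_positions (c # u) = (if c = Black then [0] else []) @ map Suc (black_positions u)"
  unfolding black_positions_def
  by (simp add: upt_conv_Cons map_Suc_upt[symmetric] filter_map o_def del: upt_Suc)

lemma black_positions_snoc:
  "black_positions (u @ [c]) = black_positions u @ (if c = Black then [length u] else [])"
  unfolding black_positions_def
  by (auto simp: nth_append intro!: filter_cong)

lemma char_seq_rotate1:
  "char_seq (rotate1 w) = (if w \<noteq> [] \<and> hd w = Black then rotate1 (char_seq w) else char_seq w)"
proof (cases w)
  case (Cons c u)
  have rot: "rotate p (u @ [e]) = rotate (Suc p) (e # u)" for p e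
    by (simp add: rotate1_rotate_swap)
  have len: "rotate (Suc (length u)) (e # u) = e # u" for e
    by (metis length_Cons rotate_id mod_self)
  show ?thesis
    using len by (cases c)
      (simp_all add: Cons char_seq_def black_positions_Cons black_positions_snoc rot o_def
        del: rotate_Suc)
qed (simp add: char_seq_def black_positions_def)

lemma regular_word_rotate1:
  assumes "regular_word w"
  shows "regular_word (rotate1 w)"
proof (cases "w \<noteq> [] \<and> hd w = Black")
  case True
  let ?a = "count_list w Red" and ?b = "count_list w Black" and ?x = "char_seq w"
  have len: "length ?x = ?b" by (simp add: char_seq_def length_black_positions)
  have b: "0 < ?b" using True by (cases w) auto
  have "rotate1 ?x ! ((i + j) mod ?b) = ?x ! ((Suc i mod ?b + j) mod ?b)" for i j
    using b len by (simp add: nth_rotate1 mod_Suc_eq mod_add_left_eq)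
  moreover have "Suc i mod ?b < ?b" for i using b by simp
  ultimately show ?thesis
    using assms True
    unfolding regular_word_def Let_def count_list_rotate1 char_seq_rotate1 by auto
next
  case False
  then show ?thesis
    using assms unfolding regular_word_def count_list_rotate1 char_seq_rotate1 by (simp only: if_False)
qed

lemma regular_necklace_iff: "regular (necklace w) \<longleftrightarrow> regular_word w"
proof
  assume "regular (necklace w)"
  moreover have "w \<in> necklace w" unfolding necklace_def by (metis rangeI rotate0 id_apply)
  ultimately show "regular_word w" by (simp add: regular_def)
next
  assume "regular_word w"
  then have "regular_word (rotate i w)" for i
    by (induction i) (auto intro: regular_word_rotate1)
  then show "regular (necklace w)" by (auto simp: regular_def necklace_def)
qed

end

theory Submission
  imports Defs
begin

text \<open>
  Read the word \<open>w\<close> periodically, so that the partial sum of the steps before position \<open>j\<close> is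
  \<open>j + (m - 1) * r j\<close>, where \<open>r j\<close> counts the red beads before \<open>j\<close>. A common vertex yields a
  window of length \<open>L > 0\<close> with \<open>R\<close> red beads such that \<open>L + R * (m - 1) = q * (m - 1)\<close>, that is
  \<open>L = t * (m - 1)\<close> and \<open>R = q - t\<close> with \<open>t \<ge> 1\<close>. Regularity forces every window to satisfy
  \<open>R > L * a / d - 1\<close>: a window with \<open>S\<close> black beads contains \<open>S - 1\<close> full gaps. Since
  \<open>a * (m - 1) = n - d\<close>, this gives \<open>q + 1 > t * n / d \<ge> k\<close>.
\<close>

section \<open>Counting beads in the periodic reading\<close>

definition cyc_nth :: "'a list \<Rightarrow> nat \<Rightarrow> 'a" where
  "cyc_nth w p = w ! (p mod length w)"

text \<open>The position is unbounded, so windows may run over several turns. Red beads are counted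
  as \<open>j - blacks_before w j\<close>; by \<open>blacks_before_le\<close> this subtraction never
  truncates.\<close>

definition blacks_before :: "bead list \<Rightarrow> nat \<Rightarrow> nat" where
  "blacks_before w j = (\<Sum>p<j. if cyc_nth w p = Black then 1 else 0)"

text \<open>The start index need not be reduced: it will be the count
  \<open>blacks_before w p\<close> at an arbitrary position of the periodic reading.\<close>

definition gap_sum :: "nat list \<Rightarrow> nat \<Rightarrow> nat \<Rightarrow> nat" where
  "gap_sum x i k = (\<Sum>j<k. x ! ((i + j) mod length x))"

lemma blacks_before_0 [simp]: "blacks_before w 0 = 0"
  by (simp add: blacks_before_def)

lemma blacks_before_Suc:
  "blacks_before w (Suc j) = blacks_before w j + (if cyc_nth w j = Black then 1 else 0)"
  by (simp add: blacks_before_def)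

lemma blacks_before_mono: "i \<le> j \<Longrightarrow> blacks_before w i \<le> blacks_before w j"
  by (rule lift_Suc_mono_le[of "blacks_before w"]) (auto simp: blacks_before_Suc)

lemma blacks_before_le: "blacks_before w j \<le> j"
  by (induction j) (auto simp: blacks_before_Suc)

lemma reds_before_mono: "i \<le> j \<Longrightarrow> i - blacks_before w i \<le> j - blacks_before w j"
proof (rule lift_Suc_mono_le[of "\<lambda>j. j - blacks_before w j"])
  show "j - blacks_before w j \<le> Suc j - blacks_before w (Suc j)" for j
    using blacks_before_le[of w j] by (auto simp: blacks_before_Suc)
qed

lemma blacks_before_filter:
  assumes "j \<le> length w"
  shows "blacks_before w j = length (filter (\<lambda>p. w ! p = Black) [0..<j])"
  using assms by (induction j) (auto simp: blacks_before_Suc cyc_nth_def)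

lemma blacks_before_length: "blacks_before w (length w) = count_list w Black"
  using blacks_before_filter[of "length w" w] length_black_positions[of w]
  by (simp add: black_positions_def)

lemma blacks_before_add_length:
  "blacks_before w (j + length w) = blacks_before w j + count_list w Black"
  by (induction j) (auto simp: blacks_before_Suc blacks_before_length cyc_nth_def)

lemma blacks_before_add_mult_length:
  "blacks_before w (j + e * length w) = blacks_before w j + e * count_list w Black"
proof (induction e)
  case (Suc e)
  have "j + Suc e * length w = (j + e * length w) + length w" by simp
  then show ?case using Suc by (simp only: blacks_before_add_length) simp
qed simp

lemma blacks_before_less:
  assumes "cyc_nth w p = Black" "p < p'"
  shows "blacks_before w p < blacks_before w p'"
  using assms blacks_before_mono[of "Suc p" p' w] by (simp add: blacks_before_Suc)

text \<open>The count rises strictly past a black bead. This identifies a bead reached by adding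
  gaps with one reached by a full turn.\<close>

lemma black_eqI:
  assumes "cyc_nth w p = Black" "cyc_nth w p' = Black" "blacks_before w p = blacks_before w p'"
  shows "p = p'"
  using assms blacks_before_less by (metis less_irrefl linorder_neqE_nat)

lemma black_positions_nth:
  assumes "p < length w" "w ! p = Black"
  shows "black_positions w ! blacks_before w p = p"
proof -
  have "[0..<length w] = [0..<p] @ p # [Suc p..<length w]"
    using assms(1) by (metis upt_conv_Cons upt_add_eq_append le_add_diff_inverse less_imp_le zero_le)
  then show ?thesis
    using assms by (simp add: black_positions_def blacks_before_filter nth_append)
qed

section \<open>Walking from black bead to black bead\<close>

lemma length_char_seq: "length (char_seq w) = count_list w Black"
  by (simp add: char_seq_def length_black_positions)

lemma nth_tl_rotate:
  assumes "t < length w - 1"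
  shows "tl (rotate p w) ! t = cyc_nth w (p + 1 + t)"
  using assms by (simp add: nth_tl nth_rotate cyc_nth_def)

text \<open>Each full turn adds exactly \<open>count_list w Black\<close> to the count, so the count
  modulo that number is the index of the bead in \<open>black_positions w\<close>.\<close>

lemma char_seq_nth_cyclic:
  assumes "w \<noteq> []" "cyc_nth w p = Black"
  shows "char_seq w ! (blacks_before w p mod count_list w Black) =
    length (takeWhile (\<lambda>c. c = Red) (tl (rotate p w)))"
proof -
  define p0 where "p0 = p mod length w"
  have p0: "p0 < length w" "w ! p0 = Black"
    using assms by (auto simp: p0_def cyc_nth_def)
  have lt: "blacks_before w p0 < count_list w Black"
    using blacks_before_less[of w p0 "length w"] assms(2) p0
    by (simp add: blacks_before_length cyc_nth_def)
  have "blacks_before w p = blacks_before w (p0 + (p div length w) * length w)"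
    by (simp add: p0_def)
  then have "blacks_before w p mod count_list w Black = blacks_before w p0"
    using lt by (simp add: blacks_before_add_mult_length)
  then show ?thesis
    using lt black_positions_nth[OF p0]
    by (simp add: char_seq_def length_black_positions p0_def rotate_conv_mod[of p w])
qed

lemma next_black:
  assumes "w \<noteq> []" "cyc_nth w p = Black"
  defines "g \<equiv> char_seq w ! (blacks_before w p mod count_list w Black)"
  shows "cyc_nth w (p + 1 + g) = Black" "blacks_before w (p + 1 + g) = blacks_before w p + 1"
proof -
  let ?u = "tl (rotate p w)"
  have g: "g = length (takeWhile (\<lambda>c. c = Red) ?u)"
    unfolding g_def by (rule char_seq_nth_cyclic[OF assms(1,2)])
  have len: "length ?u = length w - 1" by simp
  have gle: "g \<le> length w - 1"
    using length_takeWhile_le[of "\<lambda>c. c = Red" ?u] g len by simp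
  have red: "cyc_nth w (p + 1 + t) = Red" if "t < g" for t
  proof -
    have "?u ! t = Red"
      using nth_mem[of t "takeWhile (\<lambda>c. c = Red) ?u"] that g
      by (auto simp: takeWhile_nth dest: set_takeWhileD)
    then show ?thesis using that gle by (simp add: nth_tl_rotate)
  qed
  show "cyc_nth w (p + 1 + g) = Black"
  proof (cases "g < length w - 1")
    case True
    then have "?u ! g \<noteq> Red" using nth_length_takeWhile[of "\<lambda>c. c = Red" ?u] g len by simp
    then show ?thesis using True by (cases "?u ! g") (auto simp: nth_tl_rotate)
  next
    \<comment> \<open>All other beads are red, so the next black bead is the same one a turn
      later.\<close>
    case False
    then have "p + 1 + g = p + length w" using gle assms(1) by (cases w) auto
    then show ?thesis using assms(2) unfolding cyc_nth_def by (simp only: mod_add_self2)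
  qed
  have "blacks_before w (p + 1 + t) = blacks_before w p + 1" if "t \<le> g" for t
    using that by (induction t) (use assms(2) red in \<open>auto simp: blacks_before_Suc\<close>)
  then show "blacks_before w (p + 1 + g) = blacks_before w p + 1" by simp
qed

text \<open>Iterates \<open>next_black\<close>: each step crosses one gap and the black bead closing
  it. Sums of gaps thereby become distances between positions.\<close>

lemma later_black:
  assumes "w \<noteq> []" "cyc_nth w p = Black"
  defines "p' \<equiv> (\<lambda>k. p + k + gap_sum (char_seq w) (blacks_before w p) k)"
  shows "cyc_nth w (p' k) = Black \<and> blacks_before w (p' k) = blacks_before w p + k"
proof (induction k)
  case 0
  then show ?case using assms by (simp add: gap_sum_def)
next
  case (Suc k)
  have "p' (Suc k) = p' k + 1 + char_seq w ! (blacks_before w (p' k) mod count_list w Black)"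
    using Suc by (simp add: p'_def gap_sum_def length_char_seq)
  then show ?case using next_black[OF assms(1), of "p' k"] Suc by simp
qed

text \<open>The induction on \<open>j'\<close> stops where the count first exceeds its value at
  \<open>j\<close>; the bead passed there is the first black one from \<open>j\<close> on.\<close>

lemma first_black:
  assumes "blacks_before w j < blacks_before w j'"
  obtains p where "j \<le> p" "cyc_nth w p = Black" "blacks_before w p = blacks_before w j"
proof -
  have "\<exists>p\<ge>j. cyc_nth w p = Black \<and> blacks_before w p = blacks_before w j"
    using assms
  proof (induction j')
    case (Suc i)
    show ?case
    proof (cases "blacks_before w j < blacks_before w i")
      case False
      with Suc.prems have "cyc_nth w i = Black" "blacks_before w i = blacks_before w j"
        by (auto simp: blacks_before_Suc split: if_splits)
      moreover have "j \<le> i"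
        using Suc.prems blacks_before_mono[of "Suc i" j w] by (meson leD not_less_eq_eq)
      ultimately show ?thesis by blast
    qed (rule Suc.IH)
  qed simp
  then show ?thesis using that by blast
qed

section \<open>Bounds on sums of gaps\<close>

lemma count_list_Red_Black: "count_list w Red + count_list w Black = length w"
proof (induction w)
  case (Cons c w)
  then show ?case by (cases c) auto
qed simp

text \<open>After as many gaps as there are black beads, the walk is back at its starting bead one
  turn later, at distance \<open>length w\<close>.\<close>

lemma gap_sum_full:
  assumes "0 < count_list w Black"
  shows "gap_sum (char_seq w) i (count_list w Black) = count_list w Red"
proof -
  have w: "w \<noteq> []" using assms by auto
  obtain p0 where p0: "cyc_nth w p0 = Black" "blacks_before w p0 = 0"
    using first_black[of w 0 "length w"] assms by (auto simp: blacks_before_length)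
  \<comment> \<open>Walking on from count 0 reaches black beads of every count, so \<open>i\<close>
    can be arbitrary.\<close>
  obtain p where p: "cyc_nth w p = Black" "blacks_before w p = i"
    using later_black[OF w p0(1), of i] p0(2) by auto
  have "cyc_nth w (p + length w) = Black" using p(1) by (simp add: cyc_nth_def)
  moreover note later_black[OF w p(1), of "count_list w Black", unfolded p(2)]
  moreover have "blacks_before w (p + length w) = i + count_list w Black"
    using p(2) by (simp add: blacks_before_add_length)
  ultimately have "p + length w =
      p + count_list w Black + gap_sum (char_seq w) i (count_list w Black)"
    by (metis black_eqI)
  then show ?thesis using count_list_Red_Black[of w] by simp
qed

lemma gap_sum_add: "gap_sum x i (k + l) = gap_sum x i k + gap_sum x (i + k) l"
  by (induction l) (auto simp: gap_sum_def add.assoc)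

text \<open>Regularity with denominators cleared; indices are cyclic, so any start \<open>i\<close>
  reduces to one below the number of black beads.\<close>

lemma regular_word_gap_sum:
  assumes "regular_word w" "1 \<le> k" "k \<le> 1 + count_list w Black div 2" "0 < count_list w Black"
  shows "count_list w Red * k < count_list w Black * (gap_sum (char_seq w) i k + 1)"
    "count_list w Black * gap_sum (char_seq w) i k < count_list w Red * k + count_list w Black"
proof -
  let ?a = "count_list w Red" and ?b = "count_list w Black"
  let ?G = "gap_sum (char_seq w) i k"
  have G: "?G = (\<Sum>j<k. char_seq w ! ((i mod ?b + j) mod ?b))"
    by (simp add: gap_sum_def length_char_seq mod_add_left_eq)
  have "i mod ?b < ?b" "k \<in> {1..1 + ?b div 2}" using assms by auto
  then have "real ?a / real ?b * real k - 1 < real ?G \<and> real ?G < real ?a / real ?b * real k + 1"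
    using assms(1) unfolding regular_word_def Let_def G by blast
  then have "real (?a * k) < real (?b * (?G + 1)) \<and> real (?b * ?G) < real (?a * k + ?b)"
    using assms(4) by (simp add: field_simps)
  then show "?a * k < ?b * (?G + 1)" "?b * ?G < ?a * k + ?b"
    by (simp_all only: of_nat_less_iff)
qed

text \<open>Regularity speaks only of at most \<open>1 + b div 2\<close> gaps, while windows can
  contain any number of them.\<close>

lemma regular_word_gap_sum_lower:
  assumes "regular_word w" "0 < count_list w Black"
  shows "count_list w Red * k < count_list w Black * (gap_sum (char_seq w) i k + 1)"
proof (induction k arbitrary: i rule: less_induct)
  case (less k)
  let ?a = "count_list w Red" and ?b = "count_list w Black"
  consider "k = 0" | "1 \<le> k" "k \<le> 1 + ?b div 2" | "1 + ?b div 2 < k" "k < ?b" | "?b \<le> k"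
    by linarith
  then show ?case
  proof cases
    case 1
    then show ?thesis using assms(2) by simp
  next
    case 2
    then show ?thesis using regular_word_gap_sum(1) assms by blast
  next
    case 3
    \<comment> \<open>The complementary gaps number at most \<open>1 + b div 2\<close>, and all gaps sum to \<open>a\<close>.\<close>
    define l where "l = ?b - k"
    have kl: "?b = k + l" "1 \<le> l" "l \<le> 1 + ?b div 2" using 3 by (auto simp: l_def)
    have "?a = gap_sum (char_seq w) i k + gap_sum (char_seq w) (i + k) l"
      using gap_sum_full[OF assms(2), of i] kl(1) gap_sum_add by metis
    then have "?b * ?a = ?b * gap_sum (char_seq w) i k + ?b * gap_sum (char_seq w) (i + k) l"
      by (metis distrib_left)
    moreover have "?b * ?a = ?a * k + ?a * l" by (subst kl(1)) (simp add: algebra_simps)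
    ultimately show ?thesis
      using regular_word_gap_sum(2)[OF assms(1) kl(2,3) assms(2), of "i + k"]
      by (simp add: distrib_left)
  next
    case 4
    \<comment> \<open>Removing a full turn of gaps lowers both sides by exactly
      \<open>a * b\<close>.\<close>
    define l where "l = k - ?b"
    have k: "k = ?b + l" using 4 by (simp add: l_def)
    have "?a * l < ?b * (gap_sum (char_seq w) (i + ?b) l + 1)"
      using less.IH[of l] assms(2) k by simp
    moreover have "gap_sum (char_seq w) i k = ?a + gap_sum (char_seq w) (i + ?b) l"
      unfolding k gap_sum_add by (simp add: gap_sum_full[OF assms(2)])
    ultimately show ?thesis by (simp add: k algebra_simps)
  qed
qed

section \<open>Windows and the excluded displacement\<close>

text \<open>With \<open>L = R + S\<close>, \<open>a\<close> red and \<open>b\<close> black beads and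
  \<open>d = a + b\<close>, this is \<open>R > L * a / d - 1\<close> without division. The
  \<open>S - 1\<close> complete gaps hold at most \<open>R\<close> red beads, whence
  \<open>a * (S - 1) < b * (R + 1)\<close>.\<close>

lemma regular_word_window:
  assumes "regular_word w" "0 < count_list w Black"
    and "blacks_before w (j + R + S) = blacks_before w j + S"
  shows "count_list w Red * S < count_list w Black * R + length w"
proof (cases S)
  case 0
  then show ?thesis using assms(2) by auto
next
  case (Suc S')
  have w: "w \<noteq> []" using assms(2) by auto
  let ?G = "gap_sum (char_seq w) (blacks_before w j) S'"
  obtain p where p: "j \<le> p" "cyc_nth w p = Black" "blacks_before w p = blacks_before w j"
    using first_black[of w j "j + R + S"] assms(3) Suc by auto
  \<comment> \<open>The walk over \<open>S'\<close> gaps ends at the last of the \<open>S\<close>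
    black beads, still inside the window.\<close>
  have "blacks_before w (p + S' + ?G) < blacks_before w (j + R + S)"
    using later_black[OF w p(2), of S'] p(3) assms(3) Suc by simp
  then have "p + S' + ?G < j + R + S"
    using blacks_before_mono by (meson leD leI)
  then have "?G \<le> R" using p(1) Suc by simp
  then have "count_list w Black * (?G + 1) \<le> count_list w Black * (R + 1)" by simp
  then have "count_list w Red * S' < count_list w Black * (R + 1)"
    using regular_word_gap_sum_lower[OF assms(1,2)] by (rule less_le_trans[rotated])
  then show ?thesis using Suc count_list_Red_Black[of w] by (simp add: algebra_simps)
qed

lemma sum_bead_step_blacks_before:
  assumes "0 < m"
  shows "(\<Sum>p<j. bead_step m (cyc_nth w p)) = j + (m - 1) * (j - blacks_before w j)"
proof (induction j)
  case (Suc j)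
  have "blacks_before w j \<le> j" by (rule blacks_before_le)
  then show ?case using Suc assms
    by (cases "cyc_nth w j") (auto simp: blacks_before_Suc Suc_diff_le)
qed simp

text \<open>\<open>P j\<close> is the displacement after \<open>j\<close> beads, not reduced modulo
  \<open>n\<close>; with \<open>i\<close> and \<open>j\<close> unbounded, vertices that wrap around
  are covered too.\<close>

lemma regular_word_no_shift:
  assumes "regular_word w" "0 < count_list w Black" "1 < m"
    and "n = count_list w Red * m + count_list w Black"
    and "0 < q" "(q + 1) * length w \<le> n"
  defines "P \<equiv> \<lambda>j. j + (m - 1) * (j - blacks_before w j)"
  shows "P i \<noteq> P j + q * (m - 1)"
proof
  let ?a = "count_list w Red" and ?b = "count_list w Black" and ?d = "length w"
  assume eq: "P i = P j + q * (m - 1)"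
  have "0 < q * (m - 1)" using assms(3,5) by simp
  then have "P j < P i" using eq by linarith
  then have "j < i"
    using reds_before_mono[of i j w] by (metis P_def add_mono leD leI mult_le_mono2)
  define S where "S = blacks_before w i - blacks_before w j"
  define R where "R = (i - blacks_before w i) - (j - blacks_before w j)"
  have bb: "blacks_before w j \<le> blacks_before w i"
    using \<open>j < i\<close> by (simp add: blacks_before_mono)
  have i: "i = j + R + S" and Ri: "i - blacks_before w i = (j - blacks_before w j) + R"
    using bb reds_before_mono[of j i w] \<open>j < i\<close> blacks_before_le[of w i] blacks_before_le[of w j]
    by (auto simp: S_def R_def)
  have "blacks_before w (j + R + S) = blacks_before w j + S"
    unfolding i[symmetric] using bb by (simp add: S_def)
  from regular_word_window[OF assms(1,2) this] have win: "?a * S < ?b * R + ?d" .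
  have L: "R + S + (m - 1) * R = q * (m - 1)"
    using eq i unfolding P_def Ri by (simp add: distrib_left mult.commute)
  \<comment> \<open>Otherwise the red steps alone use up \<open>q * (m - 1)\<close> and the window
    is empty.\<close>
  have "R < q"
  proof (rule ccontr)
    assume "\<not> R < q"
    then have "q * (m - 1) \<le> R * (m - 1)" by simp
    then have "R + S = 0" using L by (subst (asm) (2) mult.commute) linarith
    then show False using i \<open>j < i\<close> by simp
  qed
  then obtain t where t: "q = R + t" "1 \<le> t" by (metis less_imp_add_positive Suc_leI One_nat_def)
  have L': "R + S = t * (m - 1)" using L unfolding t(1) by (simp add: distrib_right mult.commute)
  have d: "?d = ?a + ?b" using count_list_Red_Black[of w] by simp
  have n: "n = ?a * (m - 1) + ?d" using assms(3,4) d by (cases m) (auto simp: algebra_simps)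
  have "?a * (R + S) < ?d * (R + 1)" using win d by (simp add: algebra_simps)
  then have "t * (?a * (m - 1)) < ?d * (R + 1)" unfolding L' by (simp add: ac_simps)
  \<comment> \<open>Add \<open>t * d\<close> to both sides and use \<open>R + t = q\<close>.\<close>
  then have "t * n < ?d * (q + 1)" unfolding n t(1) by (simp add: algebra_simps)
  moreover have "n \<le> t * n" using t(2) by simp
  ultimately have "n < (q + 1) * ?d" by (metis le_less_trans mult.commute)
  then show False using assms(6) by simp
qed

section \<open>From displacements to vertices modulo \<open>n\<close>\<close>

lemma set_cycle_verts:
  assumes "0 < m"
  shows "set (cycle_verts n m w v) =
    (\<lambda>j. (v + (j + (m - 1) * (j - blacks_before w j))) mod n) ` {..<length w}"
proof -
  have "(\<Sum>p<j. bead_step m (w ! p)) = j + (m - 1) * (j - blacks_before w j)"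
    if "j < length w" for j
    unfolding sum_bead_step_blacks_before[OF assms, of w j, symmetric]
    using that by (intro sum.cong) (auto simp: cyc_nth_def)
  then show ?thesis
    by (auto simp: cycle_verts_def atLeast0LessThan)
qed

lemma count_list_rotate: "count_list (rotate i w) c = count_list w c"
  by (induction i) (simp_all add: count_list_rotate1)

theorem theorem8:
  fixes n m a b d k q :: nat
    and \<Delta> :: "bead list set"
    and w :: "bead list"
  assumes "n > 0" and "m > 0"
    and "n = a * m + b" and "a > 0" and "0 < b" and "b < m"
    and "d = a + b"
    and "k = n div d"
    and "\<Delta> \<in> CONF a b" and "regular \<Delta>"
    and "w \<in> \<Delta>"
    and "1 \<le> q" and "q \<le> k - 1"
  shows "set (cycle_verts n m w 0) \<inter> set (cycle_verts n m w (q * (m - 1))) = {}"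
proof -
  have counts: "count_list w Red = a" "count_list w Black = b"
    using assms(9,11) by (auto simp: CONF_def necklace_def count_list_rotate)
  have len: "length w = d" using count_list_Red_Black[of w] counts assms(7) by simp
  have reg: "regular_word w" using assms(10,11) by (simp add: regular_def)
  let ?P = "\<lambda>j. j + (m - 1) * (j - blacks_before w j)"
  \<comment> \<open>Since \<open>1 \<le> q\<close>, the subtraction in \<open>k - 1\<close> does not
    truncate and \<open>q + 1 \<le> k\<close>.\<close>
  have "(q + 1) * d \<le> k * d" using assms(12,13) by (intro mult_le_mono1) linarith
  also have "\<dots> \<le> n" using assms(8) by simp
  finally have qd: "(q + 1) * length w \<le> n" unfolding len .
  \<comment> \<open>One turn of \<open>d\<close> beads advances by \<open>n\<close>, so multiples of
    \<open>n\<close> can be traded for turns.\<close>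
  have P_period: "?P (i + e * d) = ?P i + e * n" for i e
  proof -
    have "i + e * d - blacks_before w (i + e * d) = (i - blacks_before w i) + e * a"
      using blacks_before_add_mult_length[of w i e] blacks_before_le[of w i]
      by (simp add: len counts assms(7) algebra_simps)
    moreover have "n = d + (m - 1) * a" using assms(2,3,7) by (cases m) auto
    ultimately show ?thesis by (simp add: algebra_simps)
  qed
  have False
    if "i < d" "j < d" and eq: "?P i mod n = (q * (m - 1) + ?P j) mod n" for i j
  proof -
    \<comment> \<open>The vertex on the unshifted cycle does not wrap, so only the other side loses
      a multiple of \<open>n\<close>.\<close>
    have "?P i < ?P d"
      using that(1) reds_before_mono[of i d w] by (intro add_less_le_mono mult_le_mono2) auto
    also have "?P d = n" using P_period[of 0 1] by simp
    finally have "?P i mod n = ?P i" by (rule mod_less)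
    then have "?P i + ((q * (m - 1) + ?P j) div n) * n = q * (m - 1) + ?P j"
      using eq by (metis mod_mult_div_eq mult.commute)
    \<comment> \<open>Moving \<open>i\<close> on by that many turns turns the congruence into an
      equation of natural numbers.\<close>
    then have "?P (i + ((q * (m - 1) + ?P j) div n) * d) = ?P j + q * (m - 1)"
      unfolding P_period by simp
    then show False
      using regular_word_no_shift[OF reg, of m n q] counts assms qd by auto
  qed
  then show ?thesis unfolding set_cycle_verts[OF assms(2)] len by auto
qed

end
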